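(* For any integers $k\geq 3$ and $\ell$ with $2\leq \ell\leq k-2$, and any integer $t\geq k(k-1)$, we have $\operatorname{sat}_t(n,\mathfrak{R}(H_{k,\ell}))=O(n)$ as $n\to\infty$.
   Context: $H_{k,\ell}$ is the graph obtained from a copy of $K_k$ ($k\geq 3$) by adding two new vertices $x$ and $y$, where $x$ is adjacent to exactly $\ell$ vertices of the clique and $y$ is adjacent only to $x$ (this is well defined up to isomorphism). A $t$-edge-coloured graph is a graph $G$ with a function $c:E(G)\to\{1,\dots,t\}$ (not necessarily proper). A copy of $H$ is rainbow if all its edges receive distinct colours; $\mathfrak{R}(H)$ denotes the family of rainbow copies of $H$. A $t$-edge-coloured graph is $\mathfrak{R}(H)$-saturated if it contains no rainbow copy of $H$ but adding any non-edge in any colour from $\{1,\dots,t\}$ creates a rainbow copy of $H$. $\operatorname{sat}_t(n,\mathfrak{R}(H))$ is the minimum number of edges of such a graph on $n$ vertices. *)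

theory Defs
  imports Complex_Main "HOL-Library.Landau_Symbols"
begin

datatype 'a graph = Graph (verts: "'a set") (edges: "'a set set")

definition pairs :: "'a set \<Rightarrow> 'a set set" where
  "pairs V = {e. e \<subseteq> V \<and> card e = 2}"

definition simple_graph :: "'a graph \<Rightarrow> bool" where
  "simple_graph G \<longleftrightarrow> finite (verts G) \<and> edges G \<subseteq> pairs (verts G)"

definition add_edge :: "'a graph \<Rightarrow> 'a set \<Rightarrow> 'a graph" where
  "add_edge G e = Graph (verts G) (insert e (edges G))"

definition subgraph :: "'a graph \<Rightarrow> 'a graph \<Rightarrow> bool" where
  "subgraph F G \<longleftrightarrow> verts F \<subseteq> verts G \<and> edges F \<subseteq> edges G"

definition isomorphic :: "'a graph \<Rightarrow> 'b graph \<Rightarrow> bool" where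
  "isomorphic H F \<longleftrightarrow> (\<exists>f. bij_betw f (verts H) (verts F) \<and> edges F = (\<lambda>e. f ` e) ` edges H)"

(* Only the values of a colouring c on edges matter; it is a total function on
   vertex sets, unconstrained elsewhere. *)

definition edge_coloured :: "nat \<Rightarrow> 'a graph \<Rightarrow> ('a set \<Rightarrow> nat) \<Rightarrow> bool" where
  "edge_coloured t G c \<longleftrightarrow> simple_graph G \<and> (\<forall>e \<in> edges G. c e \<in> {1..t})"

definition rainbow_copies :: "'b graph \<Rightarrow> ('a set \<Rightarrow> nat) \<Rightarrow> 'a graph set" where
  "rainbow_copies H c = {F. isomorphic H F \<and> inj_on c (edges F)}"

definition contains_rainbow :: "'b graph \<Rightarrow> 'a graph \<Rightarrow> ('a set \<Rightarrow> nat) \<Rightarrow> bool" where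
  "contains_rainbow H G c \<longleftrightarrow> (\<exists>F \<in> rainbow_copies H c. subgraph F G)"

definition rainbow_saturated :: "nat \<Rightarrow> 'b graph \<Rightarrow> 'a graph \<Rightarrow> ('a set \<Rightarrow> nat) \<Rightarrow> bool" where
  "rainbow_saturated t H G c \<longleftrightarrow>
     edge_coloured t G c \<and>
     \<not> contains_rainbow H G c \<and>
     (\<forall>e \<in> pairs (verts G) - edges G. \<forall>i \<in> {1..t}.
        contains_rainbow H (add_edge G e) (c(e := i)))"

definition rainbow_saturated_sizes :: "nat \<Rightarrow> nat \<Rightarrow> 'b graph \<Rightarrow> nat set" where
  "rainbow_saturated_sizes t n H =
     {card (edges G) | (G :: nat graph) c. card (verts G) = n \<and> rainbow_saturated t H G c}"

definition rainbow_sat :: "nat \<Rightarrow> nat \<Rightarrow> 'b graph \<Rightarrow> nat" where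
  "rainbow_sat t n H = (LEAST m. m \<in> rainbow_saturated_sizes t n H)"

(* The clique is {..<k}, x is the vertex k and y is the vertex Suc k. *)

definition H_graph :: "nat \<Rightarrow> nat \<Rightarrow> nat graph" where
  "H_graph k l = Graph {..Suc k} (pairs {..<k} \<union> {{i, k} | i. i < l} \<union> {{k, Suc k}})"

lemma simple_graph_H_graph:
  assumes "l \<le> k"
  shows "simple_graph (H_graph k l)"
  using assms by (auto simp: simple_graph_def H_graph_def pairs_def card_insert_if)

(* The minimum in rainbow_sat is over a nonempty set: a monochromatic complete
   graph is saturated. *)

lemma rainbow_saturated_sizes_nonempty:
  fixes H :: "'b graph"
  assumes H: "simple_graph H" and e: "e1 \<in> edges H" "e2 \<in> edges H" "e1 \<noteq> e2" and t: "t \<ge> 1"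
  shows "rainbow_saturated_sizes t n H \<noteq> {}"
proof -
  define G where "G = Graph {..<n} (pairs {..<n})"
  have "\<not> contains_rainbow H G (\<lambda>_. 1)"
  proof
    assume "contains_rainbow H G (\<lambda>_. 1)"
    then obtain F :: "nat graph" where "isomorphic H F" and inj: "inj_on (\<lambda>_. 1 :: nat) (edges F)"
      unfolding contains_rainbow_def rainbow_copies_def by blast
    then obtain f where f: "bij_betw f (verts H) (verts F)" "edges F = (\<lambda>e. f ` e) ` edges H"
      unfolding isomorphic_def by blast
    have "e1 \<subseteq> verts H" "e2 \<subseteq> verts H"
      using H e by (auto simp: simple_graph_def pairs_def)
    then have "f ` e1 \<noteq> f ` e2"
      using inj_on_image_eq_iff[OF bij_betw_imp_inj_on[OF f(1)]] e(3) by blast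
    then show False
      using inj_onD[OF inj, of "f ` e1" "f ` e2"] f(2) e(1,2) by simp
  qed
  then have "rainbow_saturated t H G (\<lambda>_. 1)"
    using t by (auto simp: rainbow_saturated_def edge_coloured_def simple_graph_def G_def)
  moreover have "card (verts G) = n"
    by (simp add: G_def)
  ultimately show ?thesis
    unfolding rainbow_saturated_sizes_def by blast
qed

end

theory Submission
  imports Defs
begin

text \<open>
  Take two disjoint rainbow cliques \<open>A\<close> and \<open>B\<close> on \<open>k\<close> vertices with disjoint colour sets, and
  join every further vertex to \<open>l + 1\<close> fixed vertices of \<open>A\<close> by edges in colours of \<open>B\<close>, and to
  \<open>l + 1\<close> fixed vertices of \<open>B\<close> by edges in colours of \<open>A\<close>, each colour depending only on the
  endpoint in the clique. A rainbow copy on the clique \<open>A\<close> would need a pendant edge from an outer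
  vertex into \<open>B\<close>, but the colour of that edge already occurs in \<open>A\<close>. For
  \<open>l = k - 2\<close> there are also cliques formed by an outer vertex and its neighbours in \<open>A\<close>; they
  extend to no rainbow copy, because two outer vertices see a neighbour in the same colour. Adding an edge of colour
  \<open>i\<close> between two outer vertices supplies the pendant edge: \<open>i\<close> is missing from one of the
  cliques, and among the \<open>l + 1\<close> edges to that clique there are \<open>l\<close> that avoid \<open>i\<close>. Hence any
  maximal rainbow-free extension of this graph has all its edges incident with \<open>A \<union> B\<close>.
\<close>

section \<open>Saturated extensions\<close>

lemma finite_pairs: "finite V \<Longrightarrow> finite (pairs V)"
  unfolding pairs_def by (rule finite_subset[of _ "Pow V"]) auto

lemma pair_in_pairs_iff: "{a, b} \<in> pairs V \<longleftrightarrow> a \<in> V \<and> b \<in> V \<and> a \<noteq> b"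
  unfolding pairs_def by (auto simp: card_insert_if)

lemma pairsE:
  assumes "e \<in> pairs V"
  obtains a b where "e = {a, b}" "a \<in> V" "b \<in> V" "a \<noteq> b"
  using assms unfolding pairs_def by (auto simp: card_2_iff)

lemma pairs_image:
  assumes "inj_on f V"
  shows "(\<lambda>e. f ` e) ` pairs V = pairs (f ` V)"
proof (intro equalityI subsetI)
  fix e assume "e \<in> (\<lambda>e. f ` e) ` pairs V"
  then obtain d where "d \<in> pairs V" "e = f ` d" by blast
  then show "e \<in> pairs (f ` V)"
    using assms by (auto elim!: pairsE simp: pair_in_pairs_iff inj_on_def)
next
  fix e assume "e \<in> pairs (f ` V)"
  then obtain a b where "e = f ` {a, b}" "a \<in> V" "b \<in> V" "a \<noteq> b"
    by (auto elim!: pairsE)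
  then show "e \<in> (\<lambda>e. f ` e) ` pairs V"
    by (auto simp: pair_in_pairs_iff intro!: image_eqI[where x = "{a, b}"])
qed

lemma contains_rainbow_mono:
  assumes "contains_rainbow H G c" and "subgraph G G'" and "\<And>e. e \<in> edges G \<Longrightarrow> c' e = c e"
  shows "contains_rainbow H G' c'"
proof -
  obtain F where F: "isomorphic H F" "inj_on c (edges F)" "subgraph F G"
    using assms(1) unfolding contains_rainbow_def rainbow_copies_def by blast
  have "inj_on c' (edges F)"
    using F(2,3) assms(3) unfolding subgraph_def by (subst inj_on_cong[of _ c' c]) auto
  moreover have "subgraph F G'"
    using F(3) assms(2) unfolding subgraph_def by blast
  ultimately show ?thesis
    using F(1) unfolding contains_rainbow_def rainbow_copies_def by blast
qed

text \<open>Among all rainbow-free coloured extensions on the same vertices, which keep the old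
  colours, one with the most edges exists because the number of pairs bounds their size. A non-edge
  that could be added in some colour without creating a copy would contradict this
  maximality.\<close>

lemma rainbow_saturated_extension:
  assumes "edge_coloured t G c" and "\<not> contains_rainbow H G c"
  obtains G' c' where "rainbow_saturated t H G' c'" "verts G' = verts G" "edges G \<subseteq> edges G'"
    "\<And>e. e \<in> edges G \<Longrightarrow> c' e = c e"
proof -
  define P where "P = (\<lambda>(G', c'). edge_coloured t G' c' \<and> \<not> contains_rainbow H G' c' \<and>
    verts G' = verts G \<and> edges G \<subseteq> edges G' \<and> (\<forall>e \<in> edges G. c' e = c e))"
  have fin: "finite (verts G)"
    using assms(1) by (simp add: edge_coloured_def simple_graph_def)
  have "\<forall>x. P x \<longrightarrow> card (edges (fst x)) < Suc (card (pairs (verts G)))"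
    using fin by (auto simp: P_def edge_coloured_def simple_graph_def less_Suc_eq_le
        intro!: card_mono finite_pairs)
  moreover have "P (G, c)"
    using assms by (simp add: P_def)
  ultimately obtain x where x: "P x" "\<forall>y. P y \<longrightarrow> card (edges (fst y)) \<le> card (edges (fst x))"
    using ex_has_greatest_nat[of P "(G, c)" "\<lambda>x. card (edges (fst x))"] by (metis less_imp_le)
  obtain G' c' where [simp]: "x = (G', c')" by (cases x)
  have G': "edge_coloured t G' c'" "\<not> contains_rainbow H G' c'" "verts G' = verts G"
    "edges G \<subseteq> edges G'" "\<And>e. e \<in> edges G \<Longrightarrow> c' e = c e"
    using x(1) by (auto simp: P_def)
  have finE: "finite (edges G')"
    using G'(1) finite_subset[OF _ finite_pairs] by (auto simp: edge_coloured_def simple_graph_def)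
  have "contains_rainbow H (add_edge G' e) (c'(e := i))"
    if e: "e \<in> pairs (verts G') - edges G'" and i: "i \<in> {1..t}" for e i
  proof (rule ccontr)
    assume *: "\<not> contains_rainbow H (add_edge G' e) (c'(e := i))"
    have "P (add_edge G' e, c'(e := i))"
      using G' e i * by (auto simp: P_def add_edge_def edge_coloured_def simple_graph_def)
    then have "card (edges (add_edge G' e)) \<le> card (edges G')"
      using x(2) by fastforce
    then show False
      using e finE by (simp add: add_edge_def)
  qed
  then have "rainbow_saturated t H G' c'"
    using G' unfolding rainbow_saturated_def by blast
  then show thesis
    using that G' by blast
qed

text \<open>Only the pairs in \<open>P\<close> have to be forced in \<open>G\<close>: they stay
  non-edges in every rainbow-free extension, so a saturated extension has all its edges outside
  \<open>P\<close>.\<close>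

lemma rainbow_sat_le:
  fixes G :: "nat graph"
  assumes G: "edge_coloured t G c" "\<not> contains_rainbow H G c"
    and forced: "\<And>e i. e \<in> P \<Longrightarrow> i \<in> {1..t} \<Longrightarrow> contains_rainbow H (add_edge G e) (c(e := i))"
    and "P \<inter> edges G = {}"
  shows "rainbow_sat t (card (verts G)) H \<le> card (pairs (verts G) - P)"
proof -
  obtain G' c' where G': "rainbow_saturated t H G' c'" "verts G' = verts G" "edges G \<subseteq> edges G'"
      "\<And>e. e \<in> edges G \<Longrightarrow> c' e = c e"
    using rainbow_saturated_extension[OF G] by blast
  have col: "edge_coloured t G' c'" and free: "\<not> contains_rainbow H G' c'"
    using G'(1) by (auto simp: rainbow_saturated_def)
  have "P \<inter> edges G' = {}"
  proof (rule ccontr)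
    assume "P \<inter> edges G' \<noteq> {}"
    then obtain e where e: "e \<in> P" "e \<in> edges G'" by blast
    \<comment> \<open>The colour tried is the one that the extension gives to \<open>e\<close>, so
      the copy obtained lies inside \<open>G'\<close> with the same colours.\<close>
    then have "contains_rainbow H (add_edge G e) (c(e := c' e))"
      using col by (intro forced) (auto simp: edge_coloured_def)
    then have "contains_rainbow H G' c'"
      by (rule contains_rainbow_mono) (use G' e in \<open>auto simp: subgraph_def add_edge_def\<close>)
    then show False using free by blast
  qed
  then have sub: "edges G' \<subseteq> pairs (verts G) - P" and fin: "finite (verts G)"
    using col G'(2) by (auto simp: edge_coloured_def simple_graph_def)
  have "rainbow_sat t (card (verts G)) H \<le> card (edges G')"
    unfolding rainbow_sat_def using G'(1,2)
    by (intro Least_le) (auto simp: rainbow_saturated_sizes_def)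
  also have "\<dots> \<le> card (pairs (verts G) - P)"
    using sub fin by (intro card_mono) (auto intro: finite_pairs)
  finally show ?thesis .
qed

section \<open>Rainbow copies of the pattern\<close>

text \<open>The pattern placed in an arbitrary host: \<open>K\<close> is the clique,
  \<open>X\<close> the part of it seen by \<open>x\<close>, and \<open>y\<close> the pendant vertex.
  Later arguments use these sets instead of isomorphisms.\<close>

definition H_edges :: "'a set \<Rightarrow> 'a set \<Rightarrow> 'a \<Rightarrow> 'a \<Rightarrow> 'a set set" where
  "H_edges K X x y = pairs K \<union> (\<lambda>z. {z, x}) ` X \<union> {{x, y}}"

lemma edges_H_graph: "edges (H_graph k l) = H_edges {..<k} {..<l} k (Suc k)"
  unfolding H_graph_def H_edges_def by auto

lemma H_edges_image:
  assumes "inj_on f K"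
  shows "(\<lambda>e. f ` e) ` H_edges K X x y = H_edges (f ` K) (f ` X) (f x) (f y)"
  unfolding H_edges_def pairs_image[OF assms, symmetric] by (simp add: image_Un image_image)

lemma contains_rainbow_H_graphE:
  assumes "l \<le> k" and "contains_rainbow (H_graph k l) G c"
  obtains K X x y where "card K = k" "finite K" "X \<subseteq> K" "card X = l" "x \<notin> K" "y \<notin> K" "x \<noteq> y"
    "H_edges K X x y \<subseteq> edges G" "inj_on c (H_edges K X x y)"
proof -
  obtain F f where F: "bij_betw f {..Suc k} (verts F)"
      "edges F = (\<lambda>e. f ` e) ` edges (H_graph k l)" "inj_on c (edges F)" "subgraph F G"
    using assms(2)
    unfolding contains_rainbow_def rainbow_copies_def isomorphic_def H_graph_def by auto
  have inj: "inj_on f {..Suc k}"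
    using F(1) by (rule bij_betw_imp_inj_on)
  have injk: "inj_on f {..<k}" and injl: "inj_on f {..<l}"
    using assms(1) by (auto intro: inj_on_subset[OF inj])
  have "edges F = H_edges (f ` {..<k}) (f ` {..<l}) (f k) (f (Suc k))"
    unfolding F(2) edges_H_graph by (rule H_edges_image[OF injk])
  moreover have "f k \<notin> f ` {..<k}" "f (Suc k) \<notin> f ` {..<k}" "f k \<noteq> f (Suc k)"
    by (auto simp: inj_on_eq_iff[OF inj])
  ultimately show thesis
    using F(3,4) assms(1) injk injl
    by (intro that[of "f ` {..<k}" "f ` {..<l}" "f k" "f (Suc k)"])
       (auto simp: card_image subgraph_def)
qed

lemma contains_rainbow_H_graphI:
  assumes K: "card K = k" "finite K" "K \<subseteq> verts G" and X: "X \<subseteq> K" "card X = l"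
    and xy: "x \<in> verts G - K" "y \<in> verts G - K" "x \<noteq> y"
    and E: "H_edges K X x y \<subseteq> edges G" "inj_on c (H_edges K X x y)"
  shows "contains_rainbow (H_graph k l) G c"
proof -
  have fin: "finite X" using X(1) K(2) by (rule finite_subset)
  have lk: "l \<le> k" using card_mono[OF K(2) X(1)] X(2) K(1) by simp
  obtain g where g: "bij_betw g {..<l} X"
    using finite_same_card_bij[of "{..<l}" X] fin X(2) by auto
  obtain h where h: "bij_betw h {l..<k} (K - X)"
    using finite_same_card_bij[of "{l..<k}" "K - X"] K X fin by (auto simp: card_Diff_subset)
  \<comment> \<open>In \<open>H_graph\<close> the neighbours of the vertex \<open>k\<close> in the
    clique are those below \<open>l\<close>, so these must go onto \<open>X\<close>.\<close>
  define f where "f i = (if i < l then g i else if i < k then h i else if i = k then x else y)" for i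
  have "bij_betw f {..<l} X" "bij_betw f {l..<k} (K - X)"
    using g h by (auto simp: f_def intro: bij_betw_cong[THEN iffD1, rotated])
  then have "bij_betw f ({..<l} \<union> {l..<k}) (X \<union> (K - X))"
    by (rule bij_betw_combine) auto
  moreover have "{..<l} \<union> {l..<k} = {..<k}" "X \<union> (K - X) = K"
    using lk X(1) by auto
  ultimately have fK: "bij_betw f {..<k} K" by simp
  have fxy: "f k = x" "f (Suc k) = y" using lk by (auto simp: f_def)
  have "bij_betw f ({..<k} \<union> {k}) (K \<union> {f k})"
    using fK by (rule notIn_Un_bij_betw[rotated 2]) (use xy in \<open>auto simp: fxy\<close>)
  then have "bij_betw f ({..<k} \<union> {k} \<union> {Suc k}) (K \<union> {f k} \<union> {f (Suc k)})"
    by (rule notIn_Un_bij_betw[rotated 2]) (use xy in \<open>auto simp: fxy\<close>)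
  moreover have "{..<k} \<union> {k} \<union> {Suc k} = {..Suc k}" by auto
  ultimately have bij: "bij_betw f {..Suc k} (insert y (insert x K))"
    by (simp add: fxy insert_commute)
  have fX: "f ` {..<l} = X" using \<open>bij_betw f {..<l} X\<close> by (simp add: bij_betw_def)
  have "H_edges K X x y = (\<lambda>e. f ` e) ` edges (H_graph k l)"
    unfolding edges_H_graph using fK fX fxy by (simp add: H_edges_image bij_betw_def)
  then have "isomorphic (H_graph k l) (Graph (insert y (insert x K)) (H_edges K X x y))"
    unfolding isomorphic_def using bij by (auto simp: H_graph_def)
  then show ?thesis
    unfolding contains_rainbow_def rainbow_copies_def
    using K xy E
    by (intro bexI[where x = "Graph (insert y (insert x K)) (H_edges K X x y)"])
       (auto simp: subgraph_def)
qed

section \<open>A clique with outer vertices attached\<close>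

text \<open>One half of the construction: \<open>A\<close> is the clique, \<open>N\<close> its
  attachment set, \<open>B\<close> the opposite clique and \<open>U\<close> the set of outer
  vertices. It is instantiated twice with the cliques exchanged, so only the colours of
  \<open>A\<close> are mentioned: edges from \<open>U\<close> to \<open>A\<close> avoid them, edges
  from \<open>U\<close> to \<open>B\<close> reuse them.\<close>

locale wing =
  fixes A B U N :: "'a set" and E :: "'a set set" and c :: "'a set \<Rightarrow> nat" and k l :: nat
  assumes l_ge: "2 \<le> l" and l_le: "l + 2 \<le> k"
    and finite_A: "finite A" and card_A: "card A = k"
    and N_subset: "N \<subseteq> A" and card_N: "card N = Suc l"
    and disjoint: "A \<inter> B = {}" "A \<inter> U = {}" "B \<inter> U = {}"
    and E_subset: "E \<subseteq> pairs (A \<union> B \<union> U)"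
    and pairs_A: "pairs A \<subseteq> E"
    and no_UU: "u \<in> U \<Longrightarrow> v \<in> U \<Longrightarrow> {u, v} \<notin> E"
    and no_AB: "a \<in> A \<Longrightarrow> b \<in> B \<Longrightarrow> {a, b} \<notin> E"
    and AU: "a \<in> A \<Longrightarrow> u \<in> U \<Longrightarrow> {a, u} \<in> E \<longleftrightarrow> a \<in> N"
    and inj_A: "inj_on c (pairs A)"
    and inj_N: "u \<in> U \<Longrightarrow> inj_on (\<lambda>a. c {a, u}) N"
    and AU_notin: "a \<in> N \<Longrightarrow> u \<in> U \<Longrightarrow> c {a, u} \<notin> c ` pairs A"
    and BU_in: "b \<in> B \<Longrightarrow> u \<in> U \<Longrightarrow> {b, u} \<in> E \<Longrightarrow> c {b, u} \<in> c ` pairs A"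
    and AU_eq: "a \<in> N \<Longrightarrow> u \<in> U \<Longrightarrow> v \<in> U \<Longrightarrow> c {a, u} = c {a, v}"
begin

lemma edge_verts: "{a, b} \<in> E \<Longrightarrow> a \<in> A \<union> B \<union> U \<and> b \<in> A \<union> B \<union> U \<and> a \<noteq> b"
  using E_subset pair_in_pairs_iff by (metis subsetD)

text \<open>If \<open>K = A\<close>, then \<open>x\<close> is outer and \<open>y\<close> lies in
  \<open>B\<close>, so the colour of the pendant edge repeats inside \<open>K\<close>. Otherwise
  \<open>K\<close> is an outer vertex \<open>u\<close> together with all of \<open>N\<close>: an
  outer \<open>x\<close> repeats a colour of \<open>u\<close>, and an \<open>x\<close> in
  \<open>A\<close> puts \<open>y\<close> in \<open>A\<close> as well, where there is no room for
  both.\<close>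

lemma no_rainbow_on_wing:
  assumes K: "card K = k" "finite K" "K \<subseteq> A \<union> U" and X: "X \<subseteq> K" "card X = l"
    and xy: "x \<notin> K" "y \<notin> K" "x \<noteq> y"
    and HE: "H_edges K X x y \<subseteq> E" and inj: "inj_on c (H_edges K X x y)"
  shows False
proof -
  have clique: "{a, b} \<in> E" if "a \<in> K" "b \<in> K" "a \<noteq> b" for a b
    using that HE by (auto simp: H_edges_def pair_in_pairs_iff)
  have Xx: "{z, x} \<in> E" if "z \<in> X" for z
    using that HE by (auto simp: H_edges_def)
  have Exy: "{x, y} \<in> E"
    using HE by (auto simp: H_edges_def)
  show False
  proof (cases "K \<subseteq> A")
    case True
    then have KA: "K = A"
      using card_subset_eq[OF finite_A] K(1) card_A by simp
    obtain z where z: "z \<in> X"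
      using X(2) l_ge by (cases "X = {}") auto
    have xU: "x \<in> U"
      using Xx[OF z] edge_verts[OF Xx[OF z]] no_AB z X(1) xy(1) KA by blast
    have yB: "y \<in> B"
      using Exy edge_verts[OF Exy] no_UU xU xy(2) KA by blast
    have "c {x, y} \<in> c ` pairs K"
      using BU_in[OF yB xU] Exy KA by (simp add: insert_commute)
    then obtain e where e: "e \<in> pairs K" "c e = c {x, y}" by auto
    then have "e = {x, y}"
      using inj_onD[OF inj] by (auto simp: H_edges_def)
    then show False
      using e(1) xy by (simp add: pair_in_pairs_iff)
  next
    case False
    then obtain u where u: "u \<in> K" "u \<in> U" using K(3) by blast
    have sub: "K - {u} \<subseteq> N"
    proof
      fix a assume a: "a \<in> K - {u}"
      have "a \<notin> U" using clique[of a u] no_UU a u by blast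
      then have "a \<in> A" using a K(3) by blast
      then show "a \<in> N" using AU u(2) clique[of a u] a u(1) by blast
    qed
    have finN: "finite N" using N_subset finite_A by (rule finite_subset)
    have card_Ku: "card (K - {u}) = k - 1" using u(1) K by simp
    \<comment> \<open>Here \<open>k - 1\<close> vertices fit into the \<open>l + 1\<close> vertices
      of \<open>N\<close>, so this case occurs only for \<open>l = k - 2\<close>.\<close>
    have KN: "K - {u} = N"
      using card_mono[OF finN sub] card_Ku card_N l_le by (intro card_subset_eq[OF finN sub]) simp
    \<comment> \<open>As \<open>l\<close> is at least 2, \<open>x\<close> has a neighbour in
      \<open>N\<close> and not just \<open>u\<close>; this keeps \<open>x\<close> out of
      \<open>B\<close>.\<close>
    have "\<not> X \<subseteq> {u}"
      using card_mono[of "{u}" X] X(2) l_ge by auto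
    then obtain a where a: "a \<in> X" "a \<in> N" "a \<noteq> u"
      using X(1) KN by blast
    have "x \<in> A \<union> U"
      using Xx[OF a(1)] edge_verts[OF Xx[OF a(1)]] no_AB a(2) N_subset by blast
    then show False
    proof
      assume "x \<in> U"
      then have "c {a, x} = c {a, u}" using AU_eq a(2) u(2) by blast
      moreover have "{a, x} \<in> H_edges K X x y" "{a, u} \<in> H_edges K X x y"
        using a u(1) X(1) by (auto simp: H_edges_def pair_in_pairs_iff)
      ultimately have "{a, x} = {a, u}" by (rule inj_onD[OF inj])
      then show False using a(3) u(1) xy(1) by (auto simp: doubleton_eq_iff)
    next
      assume xA: "x \<in> A"
      have "x \<notin> N" using xy(1) KN by blast
      then have yA: "y \<in> A"
        using Exy edge_verts[OF Exy] no_AB AU xA by blast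
      have "y \<notin> N" using xy(2) KN by blast
      \<comment> \<open>With \<open>card N = k - 1\<close> this is \<open>k + 1\<close>, more than
        \<open>A\<close> holds.\<close>
      then have "card (insert x (insert y N)) = Suc (Suc (card N))"
        using \<open>x \<notin> N\<close> xy(3) finN by simp
      moreover have "card (insert x (insert y N)) \<le> card A"
        using xA yA N_subset finite_A by (intro card_mono) auto
      moreover have "card N = k - 1" using KN card_Ku by simp
      ultimately show False using card_A l_le by simp
    qed
  qed
qed

text \<open>The copy has clique \<open>A\<close>, with \<open>u\<close> as \<open>x\<close> and
  \<open>v\<close> as the pendant vertex. Edges from \<open>u\<close> to \<open>N\<close> have
  distinct colours, so at most one has colour \<open>i\<close>; the spare vertex in \<open>N\<close>
  leaves \<open>l\<close> usable ones.\<close>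

lemma forced_rainbow:
  assumes uv: "u \<in> U" "v \<in> U" "u \<noteq> v" and i: "i \<notin> c ` pairs A"
    and V: "A \<union> U \<subseteq> V"
  shows "contains_rainbow (H_graph k l) (add_edge (Graph V E) {u, v}) (c({u, v} := i))"
proof -
  have finN: "finite N" using N_subset finite_A by (rule finite_subset)
  have "card {a \<in> N. c {a, u} = i} \<le> 1"
    using inj_N[OF uv(1)] finN by (auto simp: card_le_Suc0_iff_eq inj_on_def)
  then have "l \<le> card (N - {a \<in> N. c {a, u} = i})"
    using card_N finN by (subst card_Diff_subset) auto
  then obtain X where X: "X \<subseteq> N - {a \<in> N. c {a, u} = i}" "card X = l"
    by (rule obtain_subset_with_card_n)
  have XN: "X \<subseteq> N" and Xi: "\<And>a. a \<in> X \<Longrightarrow> c {a, u} \<noteq> i"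
    using X(1) by auto
  have XA: "X \<subseteq> A" using XN N_subset by blast
  have un: "u \<notin> A" "v \<notin> A" using uv disjoint by auto
  have E1: "{u, v} \<notin> pairs A" using un by (simp add: pair_in_pairs_iff)
  have E2: "{a, u} \<noteq> {u, v}" if "a \<in> X" for a
    using that XA un by (auto simp: doubleton_eq_iff)
  have injX: "inj_on c ((\<lambda>z. {z, u}) ` X)"
    using inj_N[OF uv(1)] XN by (auto simp: inj_on_def)
  define F where "F = pairs A \<union> (\<lambda>z. {z, u}) ` X"
  have disj: "c e \<noteq> c d" if "e \<in> pairs A" "d \<in> (\<lambda>z. {z, u}) ` X" for e d
  proof -
    obtain a where "a \<in> N" "d = {a, u}" using \<open>d \<in> _\<close> XN by blast
    then have "c d \<notin> c ` pairs A" using AU_notin uv(1) by simp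
    then show ?thesis using \<open>e \<in> _\<close> by (metis imageI)
  qed
  have "inj_on c F"
    unfolding F_def inj_on_Un using inj_A injX disj by blast
  moreover have new: "{u, v} \<notin> F"
    using E1 E2 by (auto simp: F_def)
  ultimately have "inj_on (c({u, v} := i)) F"
    by (auto simp: inj_on_def)
  moreover have "i \<notin> c ` F"
    using i Xi by (auto simp: F_def)
  then have "i \<notin> (c({u, v} := i)) ` F"
    using new by (auto simp: image_iff)
  ultimately have "inj_on (c({u, v} := i)) (insert {u, v} F)"
    using new by simp
  moreover have "H_edges A X u v = insert {u, v} F"
    by (simp add: H_edges_def F_def)
  moreover have "F \<subseteq> E"
    unfolding F_def using pairs_A XN XA AU uv(1) by blast
  ultimately show ?thesis
    using X(2) XA un uv finite_A card_A V
    by (intro contains_rainbow_H_graphI[of A _ _ X _ u v]) (auto simp: add_edge_def)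
qed

end

section \<open>The construction\<close>

text \<open>The cliques are \<open>{..<k}\<close> and \<open>{k..<2 * k}\<close>, the outer vertices
  are \<open>{2 * k..<n}\<close>, and the attachment sets are the first \<open>l + 1\<close>
  vertices of each clique.\<close>

definition base_edges :: "nat \<Rightarrow> nat \<Rightarrow> nat \<Rightarrow> nat set set" where
  "base_edges k l n = pairs {..<k} \<union> pairs {k..<2 * k} \<union>
     {{a, u} | a u. a \<in> {..l} \<union> {k..k + l} \<and> u \<in> {2 * k..<n}}"

text \<open>With \<open>p\<close> numbering the pairs of \<open>{..<k}\<close> by
  \<open>{1..m}\<close>, the second clique gets the palette \<open>{Suc m..2 * m}\<close>. On an
  edge to an outer vertex \<open>Min e\<close> is the clique end, since outer vertices are larger;
  its colour comes from the palette of the other clique.\<close>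

definition base_colouring :: "nat \<Rightarrow> nat \<Rightarrow> (nat set \<Rightarrow> nat) \<Rightarrow> nat set \<Rightarrow> nat" where
  "base_colouring k m p e =
     (if e \<subseteq> {..<k} then p e
      else if e \<subseteq> {k..<2 * k} then m + p ((\<lambda>x. x - k) ` e)
      else if Min e < k then m + Suc (Min e)
      else Suc (Min e - k))"

context
  fixes k l m n :: nat and p :: "nat set \<Rightarrow> nat"
  assumes l_ge: "2 \<le> l" and l_le: "l + 2 \<le> k" and n_ge: "2 * k \<le> n"
    and p: "bij_betw p (pairs {..<k}) {1..m}" and m: "2 * m = k * (k - 1)"
begin

text \<open>Each palette must supply \<open>l + 1\<close> colours for the edges to outer vertices;
  \<open>m\<close> is at least \<open>k - 1\<close>, which exceeds \<open>l\<close>.\<close>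

lemma l_less_m: "l < m"
proof -
  have "2 * (k - 1) \<le> k * (k - 1)" using l_ge l_le by (intro mult_right_mono) auto
  then show ?thesis using m l_le by linarith
qed

lemma pair_in_base_edges:
  "{a, b} \<in> base_edges k l n \<longleftrightarrow> a \<noteq> b \<and>
     (a < k \<and> b < k \<or> a \<in> {k..<2 * k} \<and> b \<in> {k..<2 * k} \<or>
      a \<in> {..l} \<union> {k..k + l} \<and> b \<in> {2 * k..<n} \<or> b \<in> {..l} \<union> {k..k + l} \<and> a \<in> {2 * k..<n})"
  using l_le unfolding base_edges_def
  by (auto simp: pair_in_pairs_iff doubleton_eq_iff)

lemma base_edges_subset: "base_edges k l n \<subseteq> pairs {..<n}"
  using l_le n_ge unfolding base_edges_def pairs_def by (auto simp: card_insert_if)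

lemma base_colouring_A: "base_colouring k m p ` pairs {..<k} = {1..m}"
  "inj_on (base_colouring k m p) (pairs {..<k})"
proof -
  have eq: "base_colouring k m p e = p e" if "e \<in> pairs {..<k}" for e
    using that by (auto simp: base_colouring_def pairs_def)
  show "base_colouring k m p ` pairs {..<k} = {1..m}"
    using p eq by (simp add: bij_betw_def cong: image_cong)
  show "inj_on (base_colouring k m p) (pairs {..<k})"
    using p eq by (simp add: bij_betw_def cong: inj_on_cong)
qed

lemma base_colouring_B: "base_colouring k m p ` pairs {k..<2 * k} = {Suc m..2 * m}"
  "inj_on (base_colouring k m p) (pairs {k..<2 * k})"
proof -
  let ?s = "\<lambda>e. (\<lambda>x. x - k) ` e"
  have eq: "base_colouring k m p e = m + p (?s e)" if e: "e \<in> pairs {k..<2 * k}" for e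
    using e by (auto elim!: pairsE simp: base_colouring_def)
  have inj: "inj_on (\<lambda>x. x - k) {k..<2 * k}" by (auto simp: inj_on_def)
  have "(\<lambda>x. x - k) ` {k..<2 * k} = {..<k}"
    by (auto simp: image_iff intro!: bexI[where x = "_ + k"])
  then have s: "?s ` pairs {k..<2 * k} = pairs {..<k}"
    using pairs_image[OF inj] by simp
  have injs: "inj_on ?s (pairs {k..<2 * k})"
    by (rule inj_on_subset[OF inj_on_image_Pow[OF inj]]) (auto simp: pairs_def)
  have "base_colouring k m p ` pairs {k..<2 * k} = (+) m ` p ` ?s ` pairs {k..<2 * k}"
    using eq by (auto simp: image_iff)
  also have "\<dots> = {Suc m..2 * m}"
    using p unfolding s by (simp add: bij_betw_def mult_2)
  finally show "base_colouring k m p ` pairs {k..<2 * k} = {Suc m..2 * m}" .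
  have "inj_on (\<lambda>e. p (?s e)) (pairs {k..<2 * k})"
    using comp_inj_on[OF injs, of p] p s by (simp add: bij_betw_def comp_def)
  then show "inj_on (base_colouring k m p) (pairs {k..<2 * k})"
    using eq by (auto simp: inj_on_def)
qed

lemma base_colouring_AU:
  assumes "a < k" and "2 * k \<le> u"
  shows "base_colouring k m p {a, u} = m + Suc a"
  using assms by (auto simp: base_colouring_def)

lemma base_colouring_BU:
  assumes "k \<le> b" and "b < 2 * k" and "2 * k \<le> u"
  shows "base_colouring k m p {b, u} = Suc (b - k)"
  using assms by (auto simp: base_colouring_def)

lemma base_wing_A:
  "wing {..<k} {k..<2 * k} {2 * k..<n} {..l} (base_edges k l n) (base_colouring k m p) k l"
proof
  show "base_edges k l n \<subseteq> pairs ({..<k} \<union> {k..<2 * k} \<union> {2 * k..<n})"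
    using base_edges_subset by (rule order_trans) (auto simp: pairs_def)
  show "pairs {..<k} \<subseteq> base_edges k l n"
    by (auto simp: base_edges_def)
  show "inj_on (base_colouring k m p) (pairs {..<k})"
    by (rule base_colouring_A(2))
next
  fix a u assume "a \<in> {..l}" "u \<in> {2 * k..<n}"
  then show "base_colouring k m p {a, u} \<notin> base_colouring k m p ` pairs {..<k}"
    unfolding base_colouring_A(1) using l_le l_less_m by (auto simp: base_colouring_AU)
next
  fix b u assume "b \<in> {k..<2 * k}" "u \<in> {2 * k..<n}" "{b, u} \<in> base_edges k l n"
  then show "base_colouring k m p {b, u} \<in> base_colouring k m p ` pairs {..<k}"
    unfolding base_colouring_A(1) using l_le l_less_m by (auto simp: base_colouring_BU pair_in_base_edges)
qed (use l_ge l_le in \<open>auto simp: pair_in_base_edges base_colouring_AU inj_on_def\<close>)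

lemma base_wing_B:
  "wing {k..<2 * k} {..<k} {2 * k..<n} {k..k + l} (base_edges k l n) (base_colouring k m p) k l"
proof
  show "base_edges k l n \<subseteq> pairs ({k..<2 * k} \<union> {..<k} \<union> {2 * k..<n})"
    using base_edges_subset by (rule order_trans) (auto simp: pairs_def)
  show "pairs {k..<2 * k} \<subseteq> base_edges k l n"
    by (auto simp: base_edges_def)
  show "inj_on (base_colouring k m p) (pairs {k..<2 * k})"
    by (rule base_colouring_B(2))
next
  fix a u assume "a \<in> {k..k + l}" "u \<in> {2 * k..<n}"
  then show "base_colouring k m p {a, u} \<notin> base_colouring k m p ` pairs {k..<2 * k}"
    unfolding base_colouring_B(1) using l_le l_less_m by (auto simp: base_colouring_BU)
next
  fix b u assume "b \<in> {..<k}" "u \<in> {2 * k..<n}" "{b, u} \<in> base_edges k l n"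
  then show "base_colouring k m p {b, u} \<in> base_colouring k m p ` pairs {k..<2 * k}"
    unfolding base_colouring_B(1) using l_le l_less_m by (auto simp: base_colouring_AU pair_in_base_edges)
qed (use l_ge l_le in \<open>auto simp: pair_in_base_edges base_colouring_BU inj_on_def\<close>)

text \<open>Since \<open>2 * m = k * (k - 1)\<close>, this is what the lower bound on
  \<open>t\<close> has to accommodate.\<close>

lemma base_colouring_range:
  assumes "e \<in> base_edges k l n"
  shows "base_colouring k m p e \<in> {1..2 * m}"
proof -
  consider "e \<in> pairs {..<k}" | "e \<in> pairs {k..<2 * k}"
    | a u where "e = {a, u}" "a \<in> {..l} \<union> {k..k + l}" "2 * k \<le> u"
    using assms unfolding base_edges_def by auto
  then show ?thesis
  proof cases
    case 1
    then have "base_colouring k m p e \<in> {1..m}" using base_colouring_A(1) by blast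
    then show ?thesis by simp
  next
    case 2
    then have "base_colouring k m p e \<in> {Suc m..2 * m}" using base_colouring_B(1) by blast
    then show ?thesis by simp
  next
    case 3
    then show ?thesis
      using l_le l_less_m by (cases "a < k") (auto simp: base_colouring_AU base_colouring_BU)
  qed
qed

lemma base_rainbow_free:
  "\<not> contains_rainbow (H_graph k l) (Graph {..<n} (base_edges k l n)) (base_colouring k m p)"
proof
  interpret A: wing "{..<k}" "{k..<2 * k}" "{2 * k..<n}" "{..l}" "base_edges k l n"
    "base_colouring k m p" k l by (rule base_wing_A)
  interpret B: wing "{k..<2 * k}" "{..<k}" "{2 * k..<n}" "{k..k + l}" "base_edges k l n"
    "base_colouring k m p" k l by (rule base_wing_B)
  assume "contains_rainbow (H_graph k l) (Graph {..<n} (base_edges k l n)) (base_colouring k m p)"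
  then obtain K X x y where K: "card K = k" "finite K" "X \<subseteq> K" "card X = l" "x \<notin> K" "y \<notin> K" "x \<noteq> y"
      "H_edges K X x y \<subseteq> base_edges k l n" "inj_on (base_colouring k m p) (H_edges K X x y)"
    by (rule contains_rainbow_H_graphE[rotated]) (use l_le in auto)
  have clique: "{a, b} \<in> base_edges k l n" if "a \<in> K" "b \<in> K" "a \<noteq> b" for a b
    using that K(8) by (auto simp: H_edges_def pair_in_pairs_iff)
  have "K \<subseteq> {..<n}"
  proof
    fix a assume a: "a \<in> K"
    have "\<not> K \<subseteq> {a}"
      using card_mono[of "{a}" K] K(1) l_ge l_le by auto
    then obtain b where "b \<in> K" "a \<noteq> b" by blast
    then have "{a, b} \<in> pairs {..<n}" using clique a base_edges_subset by blast
    then show "a \<in> {..<n}" by (simp add: pair_in_pairs_iff)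
  qed
  then have "K \<subseteq> {..<k} \<union> {k..<2 * k} \<union> {2 * k..<n}" by auto
  \<comment> \<open>No edge joins the two cliques, so \<open>K\<close> stays within one clique and
    the outer vertices, and the wing argument applies.\<close>
  moreover have "K \<inter> {..<k} = {} \<or> K \<inter> {k..<2 * k} = {}"
    using clique A.no_AB A.disjoint(1) by blast
  ultimately consider "K \<subseteq> {..<k} \<union> {2 * k..<n}" | "K \<subseteq> {k..<2 * k} \<union> {2 * k..<n}" by blast
  then show False
  proof cases
    case 1
    then show False by (rule A.no_rainbow_on_wing[OF K(1,2) _ K(3-9)])
  next
    case 2
    then show False by (rule B.no_rainbow_on_wing[OF K(1,2) _ K(3-9)])
  qed
qed

text \<open>The two palettes are disjoint, so any \<open>i\<close> is missing from one of the
  cliques, and that clique carries the copy.\<close>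

lemma base_forced:
  assumes "e \<in> pairs {2 * k..<n}"
  shows "contains_rainbow (H_graph k l) (add_edge (Graph {..<n} (base_edges k l n)) e)
           ((base_colouring k m p)(e := i))"
proof -
  obtain u v where e: "e = {u, v}" "u \<in> {2 * k..<n}" "v \<in> {2 * k..<n}" "u \<noteq> v"
    using assms by (rule pairsE)
  show ?thesis
  proof (cases "i \<in> {1..m}")
    case True
    then have "i \<notin> base_colouring k m p ` pairs {k..<2 * k}"
      unfolding base_colouring_B(1) by simp
    then show ?thesis
      unfolding e(1) by (rule wing.forced_rainbow[OF base_wing_B e(2-4)]) (use n_ge in auto)
  next
    case False
    then have "i \<notin> base_colouring k m p ` pairs {..<k}"
      unfolding base_colouring_A(1) .
    then show ?thesis
      unfolding e(1) by (rule wing.forced_rainbow[OF base_wing_A e(2-4)]) (use n_ge in auto)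
  qed
qed

lemma rainbow_sat_H_graph_le:
  assumes "k * (k - 1) \<le> t"
  shows "rainbow_sat t n (H_graph k l) \<le> 2 * k * n"
proof -
  let ?G = "Graph {..<n} (base_edges k l n)"
  have "edge_coloured t ?G (base_colouring k m p)"
    using base_colouring_range base_edges_subset assms m
    by (fastforce simp: edge_coloured_def simple_graph_def)
  moreover have "pairs {2 * k..<n} \<inter> edges ?G = {}"
    using l_le by (auto elim!: pairsE simp: pair_in_base_edges)
  ultimately have le: "rainbow_sat t (card (verts ?G)) (H_graph k l)
      \<le> card (pairs (verts ?G) - pairs {2 * k..<n})"
    using base_rainbow_free base_forced by (intro rainbow_sat_le) auto
  \<comment> \<open>A pair that is not entirely outer has an end among the \<open>2 * k\<close>
    clique vertices; listing that end first gives the linear count.\<close>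
  have "pairs (verts ?G) - pairs {2 * k..<n} \<subseteq> (\<lambda>(a, b). {a, b}) ` ({..<2 * k} \<times> {..<n})"
  proof
    fix e assume "e \<in> pairs (verts ?G) - pairs {2 * k..<n}"
    then obtain a b where ab: "e = {a, b}" "a < n" "b < n" "a < 2 * k \<or> b < 2 * k"
      by (auto elim!: pairsE simp: pair_in_pairs_iff)
    then show "e \<in> (\<lambda>(a, b). {a, b}) ` ({..<2 * k} \<times> {..<n})"
      by (force simp: image_iff)
  qed
  then have "card (pairs (verts ?G) - pairs {2 * k..<n}) \<le> card ({..<2 * k} \<times> {..<n})"
    by (intro surj_card_le) auto
  then show ?thesis using le by simp
qed

end

theorem theorem3p11:
  fixes k l t :: nat
  assumes "k \<ge> 3" and "2 \<le> l" and "l \<le> k - 2" and "t \<ge> k * (k - 1)"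
  shows "(\<lambda>n. real (rainbow_sat t n (H_graph k l))) \<in> O(\<lambda>n. real n)"
proof -
  \<comment> \<open>The number of edges of a clique, so that a palette of size \<open>m\<close>
    colours it rainbow by any numbering \<open>p\<close>.\<close>
  define m where "m = k choose 2"
  have m: "2 * m = k * (k - 1)"
    unfolding m_def choose_two by (rule dvd_mult_div_cancel) (cases "even k"; simp)
  have "card (pairs {..<k}) = card {1..m}"
    using n_subsets[of "{..<k}" 2] by (simp add: pairs_def m_def)
  then obtain p where "bij_betw p (pairs {..<k}) {1..m}"
    using finite_same_card_bij[of "pairs {..<k}" "{1..m}"] by (auto simp: finite_pairs)
  then have bound: "rainbow_sat t n (H_graph k l) \<le> 2 * k * n" if "2 * k \<le> n" for n
    using assms m that by (intro rainbow_sat_H_graph_le) auto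
  have "norm (real (rainbow_sat t n (H_graph k l))) \<le> real (2 * k) * norm (real n)"
    if "2 * k \<le> n" for n
    using of_nat_mono[OF bound[OF that], where 'a = real] by simp
  then have "\<forall>\<^sub>F n in at_top.
      norm (real (rainbow_sat t n (H_graph k l))) \<le> real (2 * k) * norm (real n)"
    by (rule eventually_at_top_linorderI)
  then show ?thesis
    by (rule bigoI)
qed

end
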